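(* For each integer $k\ge 5$, in any field of characteristic not two, every element $a$ decomposes into a product $a=a_1a_2\cdots a_k$ of $k$ factors from the field whose sum vanishes: $a_1+a_2+\dots+a_k=0$. For each positive integer $k<5$, there exists a field of characteristic not two where the similar assertion is false, i.e. a field containing an element that cannot be written as a product of $k$ elements of the field whose sum is zero.
   Context: The factors are arbitrary elements of the field (repetitions, and factors equal to $0$, $1$ or $-1$, are allowed). *)

theory Defs
  imports "HOL-Algebra.Algebra"
begin

definition ring_characteristic :: "('a, 'm) ring_scheme \<Rightarrow> nat" where
  "ring_characteristic R =
     (if \<exists>n::nat. n > 0 \<and> [n] \<cdot>\<^bsub>R\<^esub> \<one>\<^bsub>R\<^esub> = \<zero>\<^bsub>R\<^esub>
      then (LEAST n::nat. n > 0 \<and> [n] \<cdot>\<^bsub>R\<^esub> \<one>\<^bsub>R\<^esub> = \<zero>\<^bsub>R\<^esub>)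
      else 0)"

text \<open>The values of the family \<open>x\<close> need not be distinct or nonzero, and those outside
  \<open>{1..k}\<close> are irrelevant.\<close>

definition zero_sum_product :: "('a, 'm) ring_scheme \<Rightarrow> nat \<Rightarrow> 'a \<Rightarrow> bool" where
  "zero_sum_product F k a \<longleftrightarrow>
     (\<exists>x::nat \<Rightarrow> 'a. (\<forall>i\<in>{1..k}. x i \<in> carrier F) \<and>
        a = (\<Otimes>\<^bsub>F\<^esub>i\<in>{1..k}. x i) \<and> (\<Oplus>\<^bsub>F\<^esub>i\<in>{1..k}. x i) = \<zero>\<^bsub>F\<^esub>)"

end

theory Submission
  imports Defs "HOL-Number_Theory.Residues"
begin

text \<open>
  A pair \<open>x, -x\<close> does not change a sum and multiplies a product by \<open>-x\<^sup>2\<close>.  Hence \<open>a\<close>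
  has a zero-sum factorisation of length \<open>k + 2\<close> as soon as there are \<open>k\<close> factors with
  sum \<open>0\<close> and product \<open>-a\<close> times a nonzero square.  With \<open>x = 1\<close> this lifts a
  factorisation of \<open>-a\<close> of length \<open>k\<close> to one of \<open>a\<close> of length \<open>k + 2\<close>
  (\<open>zero_sum_list_extend\<close>), so only the lengths \<open>5\<close> and \<open>6\<close> need
  separate constructions.

  For length \<open>5\<close>, the identity \<open>(1 - a)\<^sup>2 - (1 + a)\<^sup>2 + 4a = 0\<close> gives three such terms, with
  product \<open>-a(2(1 - a)(1 + a))\<^sup>2\<close>; this works for \<open>a \<noteq> \<plusminus>1\<close>, and
  \<open>1 = 2 \<cdot> 2 \<cdot> (-4) \<cdot> (1/4) \<cdot> (-1/4)\<close>, with or without a change of all five signs,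
  handles the rest (\<open>zero_sum_five\<close>).

  For length \<open>6\<close>, the four terms \<open>1, -a, (a - 1)/2, (a - 1)/2\<close> serve for \<open>a \<noteq> 1\<close>, where the square root
  \<open>(a - 1)/2\<close> of the square factor is nonzero (\<open>zero_sum_six_generic\<close>).
  For \<open>a = 1\<close> (\<open>zero_sum_six_one\<close>) one has \<open>1 = 1 \<cdot> 1 \<cdot> s \<cdot> (-4s) \<cdot> x \<cdot> (-x)\<close>
  with \<open>s = 2/3\<close> and \<open>x = 3/4\<close> outside characteristic three, and six factors \<open>1\<close> in
  characteristic three.  No choice of six rational numbers with denominators prime to \<open>3\<close> could serve both cases: with sum \<open>0\<close> and
  product \<open>1\<close>, they would be all \<open>1\<close> or all \<open>-1\<close> modulo \<open>3\<close>, and writing them as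
  \<open>\<plusminus>(1 + 3t\<^sub>i)\<close>, the sum would give \<open>6 + 3\<Sum>t\<^sub>i = 0\<close> and the product
  \<open>3\<Sum>t\<^sub>i = 0\<close> modulo \<open>9\<close>.

  For the short lengths, finite prime fields give counterexamples: in \<open>\<int>/3\<close>,
  \<open>1\<close> for length \<open>1\<close> (which gives only \<open>0\<close>) and for length \<open>2\<close>
  (it is not minus a square), and \<open>2\<close> for length \<open>4\<close> (in a nonzero product all factors are
  signs, and four signs with sum divisible by three are two \<open>1\<close>s and two \<open>-1\<close>s, with
  product \<open>1\<close>);
  in \<open>\<int>/7\<close>, \<open>3\<close> for length \<open>3\<close>.  In the last case, scaling changes a product by a cube, that is by a
  sign, and up to scaling and order the zero-sum triples of nonzero elements are
  \<open>(1,1,5)\<close>, \<open>(1,2,4)\<close> and \<open>(1,3,3)\<close>, with products \<open>-2\<close>, \<open>1\<close>, \<open>2\<close>.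
\<close>

section \<open>Factorisations given by lists\<close>

text \<open>Lists are the convenient form for concrete factorisations and for adding a pair
  \<open>1, -1\<close>; this turns them into families indexed by an interval.\<close>

lemma (in cring) family_of_list:
  assumes "set xs \<subseteq> carrier R"
  shows "\<exists>x. (\<forall>i\<in>{1..length xs}. x i \<in> carrier R)
    \<and> (\<Otimes>i\<in>{1..length xs}. x i) = foldr (\<otimes>) xs \<one>
    \<and> (\<Oplus>i\<in>{1..length xs}. x i) = foldr (\<oplus>) xs \<zero>"
  using assms
proof (induction xs)
  case Nil
  then show ?case by simp
next
  case (Cons y ys)
  let ?n = "length ys"
  from Cons obtain x where x: "\<forall>i\<in>{1..?n}. x i \<in> carrier R"
    "(\<Otimes>i\<in>{1..?n}. x i) = foldr (\<otimes>) ys \<one>" "(\<Oplus>i\<in>{1..?n}. x i) = foldr (\<oplus>) ys \<zero>"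
    by auto
  have y: "y \<in> carrier R" using Cons.prems by simp
  define z where "z = x(Suc ?n := y)"
  have I: "{1..Suc ?n} = insert (Suc ?n) {1..?n}" by auto
  have z: "z \<in> {1..?n} \<rightarrow> carrier R" "z (Suc ?n) = y" "\<And>i. i \<in> {1..?n} \<Longrightarrow> z i = x i"
    using x(1) by (auto simp: z_def)
  have x_Pi: "x \<in> {1..?n} \<rightarrow> carrier R" using x(1) by auto
  have "(\<Otimes>i\<in>{1..?n}. z i) = (\<Otimes>i\<in>{1..?n}. x i)"
    using x_Pi z(3) by (intro finprod_cong') simp_all
  moreover have "(\<Oplus>i\<in>{1..?n}. z i) = (\<Oplus>i\<in>{1..?n}. x i)"
    using x_Pi z(3) by (intro add.finprod_cong') simp_all
  ultimately have "(\<Otimes>i\<in>{1..Suc ?n}. z i) = foldr (\<otimes>) (y # ys) \<one>"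
    "(\<Oplus>i\<in>{1..Suc ?n}. z i) = foldr (\<oplus>) (y # ys) \<zero>"
    using x y z unfolding I by simp_all
  moreover have "\<forall>i\<in>{1..Suc ?n}. z i \<in> carrier R"
    using z(1,2) y unfolding I by blast
  ultimately show ?case by auto
qed

definition zero_sum_list :: "('a, 'm) ring_scheme \<Rightarrow> 'a list \<Rightarrow> 'a \<Rightarrow> bool" where
  "zero_sum_list R xs a \<longleftrightarrow> set xs \<subseteq> carrier R
     \<and> foldr (\<otimes>\<^bsub>R\<^esub>) xs \<one>\<^bsub>R\<^esub> = a \<and> foldr (\<oplus>\<^bsub>R\<^esub>) xs \<zero>\<^bsub>R\<^esub> = \<zero>\<^bsub>R\<^esub>"

lemma (in cring) zero_sum_product_of_list:
  "zero_sum_list R xs a \<Longrightarrow> zero_sum_product R (length xs) a"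
  unfolding zero_sum_list_def zero_sum_product_def
  using family_of_list[of xs] by metis

text \<open>This step of length two, which changes the sign of the product, is the reason why one odd
  and one even starting length are needed.\<close>

lemma (in cring) zero_sum_list_extend:
  assumes "zero_sum_list R xs (\<ominus> a)" "a \<in> carrier R"
  shows "zero_sum_list R (\<one> # \<ominus> \<one> # xs) a"
  using assms by (simp add: zero_sum_list_def l_minus r_neg)

section \<open>Lengths five and six\<close>

lemma (in cring) square_difference_one:
  assumes "a \<in> carrier R"
  shows "(\<one> \<oplus> a) \<otimes> (\<one> \<oplus> a)
    = (\<one> \<ominus> a) \<otimes> (\<one> \<ominus> a) \<oplus> a \<otimes> ((\<one> \<oplus> \<one>) \<otimes> (\<one> \<oplus> \<one>))"
  using assms by (simp add: minus_eq l_distr r_distr l_minus r_minus minus_add a_ac r_neg r_neg1 r_neg2)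

lemma (in field) inverse_obtain:
  assumes "d \<in> carrier R" "d \<noteq> \<zero>"
  obtains x where "x \<in> carrier R" "d \<otimes> x = \<one>"
  using assms by (metis field_Units Units_r_inv_ex DiffI empty_iff insert_iff)

text \<open>The factors are \<open>(1 - a)\<^sup>2, -(1 + a)\<^sup>2, 4a, x, -x\<close>, where \<open>x\<close> inverts
  \<open>2(1 - a)(1 + a)\<close>; this is where \<open>a = \<plusminus>1\<close> has to be excluded.\<close>

lemma (in field) zero_sum_five_generic:
  assumes two: "\<one> \<oplus> \<one> \<noteq> \<zero>" and a: "a \<in> carrier R" "a \<noteq> \<one>" "a \<noteq> \<ominus> \<one>"
  shows "\<exists>xs. length xs = 5 \<and> zero_sum_list R xs a"
proof -
  define t u v where "t = \<one> \<oplus> \<one>" and "u = \<one> \<ominus> a" and "v = \<one> \<oplus> a"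
  have [simp]: "t \<in> carrier R" "u \<in> carrier R" "v \<in> carrier R" "a \<in> carrier R"
    using a by (auto simp: t_def u_def v_def)
  have "u \<noteq> \<zero>" using a by (auto simp: u_def)
  moreover have "v \<noteq> \<zero>"
    using a unfolding v_def by (metis add.inv_equality minus_minus a_comm one_closed)
  ultimately have "t \<otimes> u \<otimes> v \<noteq> \<zero>" using two by (simp add: t_def[symmetric] integral_iff)
  then obtain x where x [simp]: "x \<in> carrier R" and inv: "t \<otimes> u \<otimes> v \<otimes> x = \<one>"
    using inverse_obtain[of "t \<otimes> u \<otimes> v"] by auto
  have sq: "v \<otimes> v = u \<otimes> u \<oplus> a \<otimes> (t \<otimes> t)"
    using square_difference_one[OF a(1)] by (simp add: t_def u_def v_def)
  have "foldr (\<otimes>) [u \<otimes> u, \<ominus> (v \<otimes> v), a \<otimes> (t \<otimes> t), x, \<ominus> x] \<one>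
      = a \<otimes> ((t \<otimes> u \<otimes> v \<otimes> x) \<otimes> (t \<otimes> u \<otimes> v \<otimes> x))"
    by (simp add: l_minus r_minus m_ac)
  also have "\<dots> = a" by (simp add: inv)
  finally have "foldr (\<otimes>) [u \<otimes> u, \<ominus> (v \<otimes> v), a \<otimes> (t \<otimes> t), x, \<ominus> x] \<one> = a" .
  moreover have "foldr (\<oplus>) [u \<otimes> u, \<ominus> (v \<otimes> v), a \<otimes> (t \<otimes> t), x, \<ominus> x] \<zero> = \<zero>"
    unfolding sq by (simp add: minus_add a_ac r_neg r_neg1 r_neg2)
  ultimately show ?thesis
    by (intro exI[of _ "[u \<otimes> u, \<ominus> (v \<otimes> v), a \<otimes> (t \<otimes> t), x, \<ominus> x]"])
       (simp add: zero_sum_list_def)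
qed

text \<open>The factors are \<open>2, 2, -4, 1/4, -1/4\<close>.  Since their number is odd, changing all signs
  turns a factorisation of \<open>1\<close> into one of \<open>-1\<close>.\<close>

lemma (in field) zero_sum_five_one:
  assumes two: "\<one> \<oplus> \<one> \<noteq> \<zero>"
  obtains xs where "length xs = 5" "zero_sum_list R xs \<one>"
    "zero_sum_list R (map (\<lambda>x. \<ominus> x) xs) (\<ominus> \<one>)"
proof -
  define t where "t = \<one> \<oplus> \<one>"
  have t [simp]: "t \<in> carrier R" by (simp add: t_def)
  have "t \<otimes> t \<noteq> \<zero>" using two by (simp add: t_def[symmetric] integral_iff)
  then obtain x where x [simp]: "x \<in> carrier R" and inv: "t \<otimes> t \<otimes> x = \<one>"
    using inverse_obtain[of "t \<otimes> t"] by auto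
  let ?xs = "[t, t, \<ominus> (t \<otimes> t), x, \<ominus> x]"
  have tt: "t \<otimes> t = t \<oplus> t" by (simp add: t_def l_distr r_distr)
  have "foldr (\<otimes>) ?xs \<one> = (t \<otimes> t \<otimes> x) \<otimes> (t \<otimes> t \<otimes> x)"
    by (simp add: l_minus r_minus m_ac)
  then have prod: "foldr (\<otimes>) ?xs \<one> = \<one>" by (simp add: inv)
  have sum: "foldr (\<oplus>) ?xs \<zero> = \<zero>"
    unfolding tt by (simp add: minus_add a_ac r_neg r_neg1 r_neg2)
  have prod': "foldr (\<otimes>) (map (\<lambda>x. \<ominus> x) ?xs) \<one> = \<ominus> foldr (\<otimes>) ?xs \<one>"
    by (simp add: l_minus r_minus)
  have sum': "foldr (\<oplus>) (map (\<lambda>x. \<ominus> x) ?xs) \<zero> = \<ominus> foldr (\<oplus>) ?xs \<zero>"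
    by (simp add: minus_add)
  show thesis
    by (rule that[of ?xs])
       (use prod sum prod' sum' in \<open>simp_all add: zero_sum_list_def del: foldr_Cons\<close>)
qed

lemma (in field) zero_sum_five:
  assumes "\<one> \<oplus> \<one> \<noteq> \<zero>" "a \<in> carrier R"
  shows "\<exists>xs. length xs = 5 \<and> zero_sum_list R xs a"
proof -
  obtain xs where "length xs = 5" "zero_sum_list R xs \<one>"
    "zero_sum_list R (map (\<lambda>x. \<ominus> x) xs) (\<ominus> \<one>)"
    using zero_sum_five_one[OF assms(1)] by blast
  then show ?thesis
    using zero_sum_five_generic[OF assms] by (metis length_map)
qed

text \<open>With \<open>h = (a - 1)/2\<close>, the terms \<open>1, -a, h, h\<close> have sum \<open>0\<close> and product
  \<open>-a h\<^sup>2\<close>, and the pair \<open>1/h, -1/h\<close> cancels \<open>-h\<^sup>2\<close>.\<close>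

lemma (in field) zero_sum_six_generic:
  assumes two: "\<one> \<oplus> \<one> \<noteq> \<zero>" and a [simp]: "a \<in> carrier R" and a1: "a \<noteq> \<one>"
  shows "\<exists>xs. length xs = 6 \<and> zero_sum_list R xs a"
proof -
  obtain r where r [simp]: "r \<in> carrier R" and half: "(\<one> \<oplus> \<one>) \<otimes> r = \<one>"
    using inverse_obtain[of "\<one> \<oplus> \<one>"] two by auto
  define h where "h = r \<otimes> (a \<ominus> \<one>)"
  have h [simp]: "h \<in> carrier R" by (simp add: h_def)
  have hh: "h \<oplus> h = a \<ominus> \<one>"
  proof -
    have "h \<oplus> h = ((\<one> \<oplus> \<one>) \<otimes> r) \<otimes> (a \<ominus> \<one>)"
      by (simp add: h_def l_distr)
    then show ?thesis by (simp add: half)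
  qed
  have "h \<noteq> \<zero>"
    using hh a1 by (metis a l_zero one_closed r_right_minus_eq zero_closed)
  then obtain x where x [simp]: "x \<in> carrier R" and inv: "h \<otimes> x = \<one>"
    using inverse_obtain[of h] by auto
  let ?xs = "[\<one>, \<ominus> a, h, h, x, \<ominus> x]"
  have "foldr (\<otimes>) ?xs \<one> = a \<otimes> ((h \<otimes> x) \<otimes> (h \<otimes> x))"
    by (simp add: l_minus r_minus m_ac)
  then have "foldr (\<otimes>) ?xs \<one> = a" by (simp add: inv)
  moreover have "foldr (\<oplus>) ?xs \<zero> = \<one> \<oplus> (\<ominus> a \<oplus> (h \<oplus> h))"
    by (simp add: a_assoc r_neg)
  then have "foldr (\<oplus>) ?xs \<zero> = \<zero>"
    unfolding hh by (simp add: minus_eq a_ac r_neg r_neg1 r_neg2)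
  ultimately show ?thesis
    by (intro exI[of _ ?xs]) (simp add: zero_sum_list_def)
qed

text \<open>Outside characteristic three, \<open>1, 1, s, -4s\<close> has sum \<open>2 - 3s\<close>, which forces
  \<open>s = 2/3\<close>; its product is \<open>-(2s)\<^sup>2\<close>, and the pair is \<open>1/(2s), -1/(2s)\<close>.\<close>

lemma (in field) zero_sum_six_one:
  assumes two: "\<one> \<oplus> \<one> \<noteq> \<zero>"
  shows "\<exists>xs. length xs = 6 \<and> zero_sum_list R xs \<one>"
proof (cases "\<one> \<oplus> \<one> \<oplus> \<one> = \<zero>")
  case True
  have "\<one> \<oplus> (\<one> \<oplus> (\<one> \<oplus> (\<one> \<oplus> (\<one> \<oplus> \<one>)))) = (\<one> \<oplus> \<one> \<oplus> \<one>) \<oplus> (\<one> \<oplus> \<one> \<oplus> \<one>)"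
    by (simp add: a_ac)
  then show ?thesis
    using True by (intro exI[of _ "[\<one>, \<one>, \<one>, \<one>, \<one>, \<one>]"]) (simp add: zero_sum_list_def)
next
  case False
  define t where "t = \<one> \<oplus> \<one>"
  have t [simp]: "t \<in> carrier R" by (simp add: t_def)
  \<comment> \<open>\<open>t = 2\<close>, \<open>w = 1/3\<close>, \<open>s = 2/3\<close>, \<open>x = 3/4\<close>\<close>
  obtain w where w [simp]: "w \<in> carrier R" and third: "(\<one> \<oplus> \<one> \<oplus> \<one>) \<otimes> w = \<one>"
    using inverse_obtain[of "\<one> \<oplus> \<one> \<oplus> \<one>"] False by auto
  define s where "s = t \<otimes> w"
  have s [simp]: "s \<in> carrier R" by (simp add: s_def)
  have "s \<oplus> s \<oplus> s = t \<otimes> ((\<one> \<oplus> \<one> \<oplus> \<one>) \<otimes> w)"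
    by (simp add: s_def l_distr r_distr)
  then have sss: "s \<oplus> s \<oplus> s = t" by (simp add: third)
  have "s \<noteq> \<zero>" using sss two by (auto simp: t_def)
  then have "t \<otimes> s \<noteq> \<zero>" using two by (simp add: t_def[symmetric] integral_iff)
  then obtain x where x [simp]: "x \<in> carrier R" and inv: "t \<otimes> s \<otimes> x = \<one>"
    using inverse_obtain[of "t \<otimes> s"] by auto
  let ?xs = "[\<one>, \<one>, s, \<ominus> (t \<otimes> t \<otimes> s), x, \<ominus> x]"
  have tts: "t \<otimes> t \<otimes> s = s \<oplus> (s \<oplus> s \<oplus> s)" by (simp add: t_def l_distr r_distr a_ac)
  have "foldr (\<otimes>) ?xs \<one> = (t \<otimes> s \<otimes> x) \<otimes> (t \<otimes> s \<otimes> x)"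
    by (simp add: l_minus r_minus m_ac)
  then have "foldr (\<otimes>) ?xs \<one> = \<one>" by (simp add: inv)
  moreover have "foldr (\<oplus>) ?xs \<zero> = \<one> \<oplus> (\<one> \<oplus> (s \<oplus> \<ominus> (s \<oplus> t)))"
    unfolding tts sss by (simp add: r_neg)
  then have "foldr (\<oplus>) ?xs \<zero> = \<zero>"
    by (simp add: t_def minus_add a_ac r_neg r_neg1 r_neg2)
  ultimately show ?thesis
    by (intro exI[of _ ?xs]) (simp add: zero_sum_list_def)
qed

section \<open>All lengths from five on\<close>

lemma (in field) zero_sum_list_exists:
  assumes "\<one> \<oplus> \<one> \<noteq> \<zero>" "5 \<le> k" "a \<in> carrier R"
  shows "\<exists>xs. length xs = k \<and> zero_sum_list R xs a"
  using assms(2,3)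
proof (induction k arbitrary: a rule: less_induct)
  case (less k)
  consider "k = 5" | "k = 6" | "7 \<le> k" using less.prems by linarith
  then show ?case
  proof cases
    case 1
    then show ?thesis using zero_sum_five assms(1) less.prems by simp
  next
    case 2
    then show ?thesis
      using zero_sum_six_generic zero_sum_six_one assms(1) less.prems by metis
  next
    case 3
    then obtain xs where "length xs = k - 2" "zero_sum_list R xs (\<ominus> a)"
      using less.IH[of "k - 2" "\<ominus> a"] less.prems by fastforce
    then show ?thesis
      using 3 zero_sum_list_extend[of xs a] less.prems
      by (intro exI[of _ "\<one> # \<ominus> \<one> # xs"]) auto
  qed
qed

lemma (in domain) ring_characteristic_eq_2_iff:
  "ring_characteristic R = 2 \<longleftrightarrow> \<one> \<oplus> \<one> = \<zero>"
proof -
  let ?P = "\<lambda>n::nat. n > 0 \<and> [n] \<cdot> \<one> = \<zero>"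
  have two: "[(2::nat)] \<cdot> \<one> = \<one> \<oplus> \<one>" by (simp add: numeral_2_eq_2)
  show ?thesis
  proof
    assume R: "ring_characteristic R = 2"
    then have ex: "\<exists>n. ?P n" by (auto simp: ring_characteristic_def split: if_splits)
    then have "(LEAST n. ?P n) = 2" using R by (simp add: ring_characteristic_def)
    then show "\<one> \<oplus> \<one> = \<zero>" using LeastI_ex[OF ex] two by simp
  next
    assume "\<one> \<oplus> \<one> = \<zero>"
    then have P2: "?P 2" using two by simp
    have "(LEAST n. ?P n) = 2"
    proof (rule Least_equality)
      fix n assume n: "?P n"
      have "n \<noteq> 1" using n by (auto simp: one_not_zero)
      then show "2 \<le> n" using n by linarith
    qed (fact P2)
    then show "ring_characteristic R = 2"
      using exI[of ?P, OF P2] by (simp add: ring_characteristic_def)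
  qed
qed

lemma (in field) zero_sum_product_exists:
  assumes "ring_characteristic R \<noteq> 2" "5 \<le> k" "a \<in> carrier R"
  shows "zero_sum_product R k a"
  using assms zero_sum_list_exists zero_sum_product_of_list ring_characteristic_eq_2_iff by metis

section \<open>Short lengths over finite prime fields\<close>

text \<open>Over \<open>\<int>/m\<close>, products and sums may be computed in \<open>\<int>\<close> and reduced at the end,
  which leaves finitely many integer tuples to check.\<close>

lemma (in residues) zero_sum_product_residues:
  assumes "zero_sum_product R k a"
  obtains x where "\<forall>i\<in>{1..k}. x i \<in> {0..<m}"
    "a = (\<Prod>i\<in>{1..k}. x i) mod m" "(\<Sum>i\<in>{1..k}. x i) mod m = 0"
proof -
  from assms obtain x where x: "\<forall>i\<in>{1..k}. x i \<in> carrier R"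
    and a: "a = (\<Otimes>i\<in>{1..k}. x i)" and s: "(\<Oplus>i\<in>{1..k}. x i) = \<zero>"
    unfolding zero_sum_product_def by blast
  have x_mod: "x i mod m = x i" if "i \<in> {1..k}" for i
    using x that by (auto simp: res_carrier_eq)
  have "(\<Otimes>i\<in>{1..k}. x i) = (\<Otimes>i\<in>{1..k}. x i mod m)"
    by (rule finprod_cong') (use x_mod in auto)
  then have "a = (\<Prod>i\<in>{1..k}. x i) mod m" using a by (simp add: prod_cong)
  moreover have "(\<Oplus>i\<in>{1..k}. x i) = (\<Oplus>i\<in>{1..k}. x i mod m)"
    by (rule add.finprod_cong') (use x_mod in auto)
  then have "(\<Sum>i\<in>{1..k}. x i) mod m = 0" using s by (simp add: sum_cong res_zero_eq)
  ultimately show thesis using x by (intro that[of x]) (auto simp: res_carrier_eq)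
qed

lemma residue_field_characteristic:
  assumes "Factorial_Ring.prime p" "2 < p"
  shows "field (residue_ring (int p))" "ring_characteristic (residue_ring (int p)) \<noteq> 2"
proof -
  interpret residues_prime p "residue_ring (int p)"
    using assms by unfold_locales simp_all
  show "field (residue_ring (int p))" by (rule is_field)
  show "ring_characteristic (residue_ring (int p)) \<noteq> 2"
    using assms by (simp add: ring_characteristic_eq_2_iff res_add_eq res_one_eq res_zero_eq)
qed

lemma residues_3: "residues 3" and residues_7: "residues 7"
  by unfold_locales simp_all

lemma zero_sum_pairs_mod_3:
  "\<forall>x\<in>{0, 1, 2}. \<forall>y\<in>{0, 1, 2::int}. (x + y) mod 3 = 0 \<longrightarrow> x * y mod 3 \<noteq> 1"
  by simp

lemma zero_sum_triples_mod_7: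
  "\<forall>x\<in>{0, 1, 2, 3, 4, 5, 6}. \<forall>y\<in>{0, 1, 2, 3, 4, 5, 6}.
     \<forall>z\<in>{0, 1, 2, 3, 4, 5, 6::int}. (x + (y + z)) mod 7 = 0 \<longrightarrow> x * (y * z) mod 7 \<noteq> 3"
  by simp

lemma zero_sum_quadruples_mod_3:
  "\<forall>x\<in>{0, 1, 2}. \<forall>y\<in>{0, 1, 2}. \<forall>z\<in>{0, 1, 2}. \<forall>w\<in>{0, 1, 2::int}.
     (x + (y + (z + w))) mod 3 = 0 \<longrightarrow> x * (y * (z * w)) mod 3 \<noteq> 2"
  by simp

lemma not_zero_sum_product_1: "\<not> zero_sum_product (residue_ring 3) 1 1"
proof
  assume "zero_sum_product (residue_ring 3) 1 1"
  then show False by (rule residues.zero_sum_product_residues[OF residues_3]) simp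
qed

lemma not_zero_sum_product_2: "\<not> zero_sum_product (residue_ring 3) 2 1"
proof
  assume "zero_sum_product (residue_ring 3) 2 1"
  then obtain x where x: "\<forall>i\<in>{1..2}. x i \<in> {0..<3::int}"
    "1 = (\<Prod>i\<in>{1..2::nat}. x i) mod 3" "(\<Sum>i\<in>{1..2::nat}. x i) mod 3 = 0"
    by (rule residues.zero_sum_product_residues[OF residues_3])
  have I: "{1..2::nat} = {1, 2}" by auto
  have eqs: "x 1 * x 2 mod 3 = 1" "(x 1 + x 2) mod 3 = 0"
    using x(2,3) unfolding I by simp_all
  have mems: "x 1 \<in> {0, 1, 2}" "x 2 \<in> {0, 1, 2}"
    using x(1) unfolding I by (simp_all, presburger+)
  show False
    using zero_sum_pairs_mod_3[rule_format, OF mems eqs(2)] eqs(1) by (rule notE)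
qed

lemma not_zero_sum_product_3: "\<not> zero_sum_product (residue_ring 7) 3 3"
proof
  assume "zero_sum_product (residue_ring 7) 3 3"
  then obtain x where x: "\<forall>i\<in>{1..3}. x i \<in> {0..<7::int}"
    "3 = (\<Prod>i\<in>{1..3::nat}. x i) mod 7" "(\<Sum>i\<in>{1..3::nat}. x i) mod 7 = 0"
    by (rule residues.zero_sum_product_residues[OF residues_7])
  have I: "{1..3::nat} = {1, 2, 3}" by auto
  have eqs: "x 1 * (x 2 * x 3) mod 7 = 3" "(x 1 + (x 2 + x 3)) mod 7 = 0"
    using x(2,3) unfolding I by simp_all
  have mems: "x 1 \<in> {0, 1, 2, 3, 4, 5, 6}" "x 2 \<in> {0, 1, 2, 3, 4, 5, 6}" "x 3 \<in> {0, 1, 2, 3, 4, 5, 6}"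
    using x(1) unfolding I by (simp_all, presburger+)
  show False
    using zero_sum_triples_mod_7[rule_format, OF mems eqs(2)] eqs(1) by (rule notE)
qed

lemma not_zero_sum_product_4: "\<not> zero_sum_product (residue_ring 3) 4 2"
proof
  assume "zero_sum_product (residue_ring 3) 4 2"
  then obtain x where x: "\<forall>i\<in>{1..4}. x i \<in> {0..<3::int}"
    "2 = (\<Prod>i\<in>{1..4::nat}. x i) mod 3" "(\<Sum>i\<in>{1..4::nat}. x i) mod 3 = 0"
    by (rule residues.zero_sum_product_residues[OF residues_3])
  have I: "{1..4::nat} = {1, 2, 3, 4}" by auto
  have eqs: "x 1 * (x 2 * (x 3 * x 4)) mod 3 = 2" "(x 1 + (x 2 + (x 3 + x 4))) mod 3 = 0"
    using x(2,3) unfolding I by simp_all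
  have mems: "x 1 \<in> {0, 1, 2}" "x 2 \<in> {0, 1, 2}" "x 3 \<in> {0, 1, 2}" "x 4 \<in> {0, 1, 2}"
    using x(1) unfolding I by (simp_all, presburger+)
  show False
    using zero_sum_quadruples_mod_3[rule_format, OF mems eqs(2)] eqs(1) by (rule notE)
qed

lemma zero_sum_product_counterexample:
  assumes "0 < k" "k < 5"
  shows "\<exists>F :: int ring. field F \<and> ring_characteristic F \<noteq> 2
    \<and> (\<exists>a \<in> carrier F. \<not> zero_sum_product F k a)"
proof -
  have F3: "field (residue_ring 3)" "ring_characteristic (residue_ring 3) \<noteq> 2"
    using residue_field_characteristic[of 3] by simp_all
  have F7: "field (residue_ring 7)" "ring_characteristic (residue_ring 7) \<noteq> 2"
    using residue_field_characteristic[of 7] by simp_all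
  have mem: "1 \<in> carrier (residue_ring 3)" "2 \<in> carrier (residue_ring 3)"
    "3 \<in> carrier (residue_ring 7)"
    by (simp_all add: residue_ring_def)
  consider "k = 1" | "k = 2" | "k = 3" | "k = 4" using assms by linarith
  then show ?thesis
  proof cases
    case 1
    then show ?thesis using F3 mem(1) not_zero_sum_product_1 by metis
  next
    case 2
    then show ?thesis using F3 mem(1) not_zero_sum_product_2 by metis
  next
    case 3
    then show ?thesis using F7 mem(3) not_zero_sum_product_3 by metis
  next
    case 4
    then show ?thesis using F3 mem(2) not_zero_sum_product_4 by metis
  qed
qed

theorem theorem1:
  shows "(\<forall>k::nat. k \<ge> 5 \<longrightarrow>
            (\<forall>F :: 'a ring. field F \<longrightarrow> ring_characteristic F \<noteq> 2 \<longrightarrow>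
               (\<forall>a \<in> carrier F. zero_sum_product F k a))) \<and>
         (\<forall>k::nat. 0 < k \<and> k < 5 \<longrightarrow>
            (\<exists>F :: int ring. field F \<and> ring_characteristic F \<noteq> 2 \<and>
               (\<exists>a \<in> carrier F. \<not> zero_sum_product F k a)))"
proof (intro conjI allI impI ballI)
  fix k :: nat and F :: "'a ring" and a
  assume "5 \<le> k" "field F" "ring_characteristic F \<noteq> 2" "a \<in> carrier F"
  then show "zero_sum_product F k a" by (intro field.zero_sum_product_exists)
next
  fix k :: nat
  assume "0 < k \<and> k < 5"
  then show "\<exists>F :: int ring. field F \<and> ring_characteristic F \<noteq> 2 \<and>
      (\<exists>a \<in> carrier F. \<not> zero_sum_product F k a)"
    by (elim conjE) (rule zero_sum_product_counterexample)
qed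

end
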